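(* Let $N\ge 2$ and $T\ge 1$ be integers, and let $l_{i,t}$ (losses) and $\lambda_{i,t}$ (lower bounds), $1\le i\le N$, $1\le t\le T$, be real numbers with $\lambda_{i,t}\le l_{i,t}$, fixed in advance (oblivious adversary). Put $s_{i,t}=l_{i,t}-\lambda_{i,t}$ and $\mathbf{s}_t=(s_{1,t},\ldots,s_{N,t})$, $\boldsymbol{\lambda}_t=(\lambda_{1,t},\ldots,\lambda_{N,t})$. Let $\mathcal{Q}>0$ be an upper bound on $$\frac{1}{2} q(\boldsymbol{\lambda}_{1:T})+2\sum_{t=1}^T \|\mathbf{s}_t\|^2+4\sum_{t=1}^T \max_i\{s_{i,t}\}\cdot d(\boldsymbol{\lambda}_t).$$ Then for any $\eta>0$, the pseudo-regret of the algorithm Exp3.LB run with parameter $\eta$ satisfies $$\overline{R}_{Exp3.LB,T} \leq \frac{1}{\eta}\log N + \frac{1}{4}\eta\, \mathcal{Q},$$ and in particular, for $\eta = \sqrt{4\log N/\mathcal{Q}}$, $$\overline{R}_{Exp3.LB,T} \leq \sqrt{\mathcal{Q} \log N}.$$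
   Context: Notation: $\|\cdot\|$ is the Euclidean norm; for $\mathbf{x}\in\mathbb{R}^N$, $d(\mathbf{x})=\max_i\{x_i\}-\min_i\{x_i\}$; for vectors $\mathbf{x}_1,\ldots,\mathbf{x}_T\in\mathbb{R}^N$, $q(\mathbf{x}_{1:T})=\sum_{t=1}^T d(\mathbf{x}_t)^2$; $\log$ is the natural logarithm. Model: there are $N$ experts and $T$ rounds. On each round $t$ the learner picks a probability distribution $\mathbf{p}_t$ on $\{1,\ldots,N\}$ (depending on past observations), draws $I_t\sim\mathbf{p}_t$ (conditionally on the past), incurs loss $l_{I_t,t}$, and observes $l_{I_t,t}$ and all of $\lambda_{1,t},\ldots,\lambda_{N,t}$. Exp3.LB with parameter $\eta>0$: $\mathbf{p}_1$ is uniform and $\widetilde{L}_{i,0}=0$ for all $i$. On each round $t=1,\ldots,T$: draw $I_t\sim\mathbf{p}_t$; set $\widetilde{l}_{i,t} = \frac{s_{i,t}}{p_{i,t}}\mathbb{I}\{I_t=i\}+\lambda_{i,t}$ and $\widetilde{L}_{i,t}=\widetilde{L}_{i,t-1}+\widetilde{l}_{i,t}$ for every $i$; set $p_{i,t+1}=\exp(-\eta \widetilde{L}_{i,t})/\sum_{k=1}^N\exp(-\eta\widetilde{L}_{k,t})$. With $L_{i,T}=\sum_{t=1}^T l_{i,t}$ and $L_{Exp3.LB,T}=\sum_{t=1}^T l_{I_t,t}$, the pseudo-regret is $\overline{R}_{Exp3.LB,T}=\mathbb{E}[L_{Exp3.LB,T}]-\min_i\mathbb{E}[L_{i,T}]$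 (which for an oblivious adversary equals the expected regret). *)

theory Defs
  imports "HOL-Probability.Probability"
begin

text \<open>
  Experts are the elements of a finite type \<open>'n\<close> with \<open>CARD('n)\<close> elements. Rounds are the natural
  numbers \<open>1, \<dots>, T\<close>; values of the sequences \<open>l\<close> and \<open>lam\<close> at other indices are irrelevant.
\<close>

definition spread :: "real ^ 'n \<Rightarrow> real" where
  "spread x = (MAX i\<in>UNIV. x $ i) - (MIN i\<in>UNIV. x $ i)"

definition sq_spread_sum :: "(nat \<Rightarrow> real ^ 'n) \<Rightarrow> nat \<Rightarrow> real" where
  "sq_spread_sum x T = (\<Sum>t=1..T. (spread (x t))\<^sup>2)"

definition exp_weights :: "real \<Rightarrow> real ^ 'n \<Rightarrow> 'n pmf" where
  "exp_weights \<eta> L = embed_pmf (\<lambda>i. exp (- \<eta> * L $ i) / (\<Sum>k\<in>UNIV. exp (- \<eta> * L $ k)))"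

lemma pmf_exp_weights:
  "pmf (exp_weights \<eta> L) i = exp (- \<eta> * L $ i) / (\<Sum>k\<in>UNIV. exp (- \<eta> * L $ k))"
proof -
  have pos: "(\<Sum>k\<in>UNIV. exp (- \<eta> * L $ k)) > 0"
    by (intro sum_pos) auto
  have "(\<Sum>i\<in>UNIV. exp (- \<eta> * L $ i) / (\<Sum>k\<in>UNIV. exp (- \<eta> * L $ k))) = 1"
    unfolding sum_divide_distrib [symmetric] using pos by simp
  then show ?thesis
    unfolding exp_weights_def using pos
    by (intro pmf_embed_pmf) (simp_all add: nn_integral_count_space_finite)
qed

definition play_dist :: "real \<Rightarrow> nat \<Rightarrow> real ^ 'n \<Rightarrow> 'n pmf" where
  "play_dist \<eta> t L = (if t = 1 then pmf_of_set UNIV else exp_weights \<eta> L)"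

definition loss_estimate :: "real ^ 'n \<Rightarrow> real ^ 'n \<Rightarrow> 'n pmf \<Rightarrow> 'n \<Rightarrow> real ^ 'n" where
  "loss_estimate s lam p I = (\<chi> i. s $ i / pmf p i * of_bool (I = i) + lam $ i)"

text \<open>
  Joint law, after \<open>t\<close> rounds, of the list \<open>[I\<^sub>1, \<dots>, I\<^sub>t]\<close> of drawn experts and of the vector of
  cumulative loss estimates.
\<close>

primrec exp3lb :: "real \<Rightarrow> (nat \<Rightarrow> real ^ 'n) \<Rightarrow> (nat \<Rightarrow> real ^ 'n) \<Rightarrow> nat
    \<Rightarrow> ('n list \<times> (real ^ 'n)) pmf" where
  "exp3lb \<eta> l lam 0 = return_pmf ([], 0)"
| "exp3lb \<eta> l lam (Suc t) = do {
     (Is, L) \<leftarrow> exp3lb \<eta> l lam t;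
     let p = play_dist \<eta> (Suc t) L;
     I \<leftarrow> p;
     return_pmf (Is @ [I], L + loss_estimate (l (Suc t) - lam (Suc t)) (lam (Suc t)) p I)
   }"

text \<open>The expert drawn in round \<open>t\<close> is \<open>Is ! (t - 1)\<close>, since list positions start at \<open>0\<close>.\<close>

definition learner_loss :: "(nat \<Rightarrow> real ^ 'n) \<Rightarrow> nat \<Rightarrow> 'n list \<Rightarrow> real" where
  "learner_loss l T Is = (\<Sum>t=1..T. l t $ (Is ! (t - 1)))"

definition expert_loss :: "(nat \<Rightarrow> real ^ 'n) \<Rightarrow> nat \<Rightarrow> 'n \<Rightarrow> real" where
  "expert_loss l T i = (\<Sum>t=1..T. l t $ i)"

definition pseudo_regret ::
  "real \<Rightarrow> (nat \<Rightarrow> real ^ 'n) \<Rightarrow> (nat \<Rightarrow> real ^ 'n) \<Rightarrow> nat \<Rightarrow> real" where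
  "pseudo_regret \<eta> l lam T =
     measure_pmf.expectation (exp3lb \<eta> l lam T) (\<lambda>(Is, L). learner_loss l T Is)
     - (MIN i\<in>UNIV. measure_pmf.expectation (exp3lb \<eta> l lam T) (\<lambda>_. expert_loss l T i))"

end

theory Submission
  imports Defs
begin

text \<open>
  The potential is \<open>ln (\<Sum>k. exp (- \<eta> * L $ k))\<close>. Conditionally on the past, its increment in a
  round is \<open>ln Z + ln (1 - q\<^sub>I (1 - exp (- \<eta> s\<^sub>I / p\<^sub>I)))\<close>, where \<open>q\<^sub>i = p\<^sub>i exp (- \<eta> \<lambda>\<^sub>i) / Z\<close> are
  the weights tilted by the lower bounds, with normalising constant \<open>Z\<close>. Hoeffding's lemma bounds
  \<open>ln Z\<close> and yields the term \<open>d(\<lambda>)\<^sup>2 / 8\<close>; the second summand is a Bernoulli log-moment generating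
  function and yields \<open>\<parallel>s\<parallel>\<^sup>2 / 2\<close>, up to the error made by replacing \<open>q\<close> by \<open>p\<close>. As
  \<open>q\<^sub>i \<ge> p\<^sub>i exp (- \<eta> d(\<lambda>))\<close>, that error is at most \<open>\<eta> max\<^sub>i s\<^sub>i d(\<lambda>)\<close>.
\<close>

section \<open>Scalar bounds on log-moment generating functions\<close>

lemma ln_sum_exp_le_Hoeffding:
  fixes P :: "'a :: finite pmf"
  assumes "\<eta> > 0" and bounds: "\<And>i. a \<le> f i" "\<And>i. f i \<le> b"
  shows "ln (\<Sum>i\<in>UNIV. pmf P i * exp (- \<eta> * f i))
    \<le> - \<eta> * (\<Sum>i\<in>UNIV. pmf P i * f i) + \<eta>\<^sup>2 * (b - a)\<^sup>2 / 8"
proof -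
  \<comment> \<open>Passing to \<open>- f\<close> turns the exponent \<open>- \<eta> * f\<close>
    into one with positive parameter \<open>\<eta>\<close>; the range keeps its length
    \<open>b - a\<close>.\<close>
  interpret interval_bounded_random_variable "measure_pmf P" "\<lambda>i. - f i" "- b" "- a"
    by unfold_locales (use bounds in \<open>auto simp: AE_measure_pmf_iff\<close>)
  define \<mu> where "\<mu> = (\<Sum>i\<in>UNIV. pmf P i * f i)"
  have mean: "measure_pmf.expectation P (\<lambda>i. - f i) = - \<mu>"
    by (simp add: integral_measure_pmf[of UNIV] \<mu>_def sum_negf)
  have "ennreal (\<Sum>i\<in>UNIV. pmf P i * exp (\<eta> * (- f i - - \<mu>)))
      = (\<integral>\<^sup>+i. ennreal (exp (\<eta> * (- f i - - \<mu>))) \<partial>measure_pmf P)"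
    by (subst nn_integral_eq_integral)
       (auto intro!: integrable_measure_pmf_finite simp: integral_measure_pmf[of UNIV])
  also have "\<dots> \<le> ennreal (exp (\<eta>\<^sup>2 * (b - a)\<^sup>2 / 8))"
    using Hoeffdings_lemma_nn_integral[OF \<open>\<eta> > 0\<close>] unfolding mean by simp
  finally have "(\<Sum>i\<in>UNIV. pmf P i * exp (\<eta> * (- f i - - \<mu>))) \<le> exp (\<eta>\<^sup>2 * (b - a)\<^sup>2 / 8)"
    by (simp add: ennreal_le_iff)
  also have "(\<Sum>i\<in>UNIV. pmf P i * exp (\<eta> * (- f i - - \<mu>)))
      = exp (\<eta> * \<mu>) * (\<Sum>i\<in>UNIV. pmf P i * exp (- \<eta> * f i))"
    by (simp add: sum_distrib_left algebra_simps exp_diff exp_minus divide_simps)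
  finally have le: "(\<Sum>i\<in>UNIV. pmf P i * exp (- \<eta> * f i))
      \<le> exp (- \<eta> * \<mu> + \<eta>\<^sup>2 * (b - a)\<^sup>2 / 8)"
    by (simp add: exp_diff pos_le_divide_eq mult.commute)
  \<comment> \<open>\<open>P\<close> may vanish at some points, so a point of its support witnesses
    that the argument of \<open>ln\<close> is positive.\<close>
  obtain i where "i \<in> set_pmf P"
    using set_pmf_not_empty by fast
  then have "(\<Sum>i\<in>UNIV. pmf P i * exp (- \<eta> * f i)) > 0"
    by (intro sum_pos2[of UNIV i]) (auto simp: pmf_positive)
  with le show ?thesis
    unfolding \<mu>_def by (metis ln_exp ln_le_cancel_iff exp_gt_zero)
qed

text \<open>The difference of the two sides vanishes at 0, and its derivative
  \<open>exp (- y) - (1 - y)\<close> is nonnegative by convexity of the exponential.\<close>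

lemma exp_minus_le_quadratic:
  fixes x :: real
  assumes "x \<ge> 0"
  shows "exp (- x) \<le> 1 - x + x\<^sup>2 / 2"
proof -
  let ?g = "\<lambda>x::real. 1 - x + x\<^sup>2 / 2 - exp (- x)"
  have "?g 0 \<le> ?g x"
  proof (rule DERIV_nonneg_imp_nondecreasing[OF assms])
    fix y :: real
    have "(?g has_real_derivative - 1 + y + exp (- y)) (at y)"
      by (auto intro!: derivative_eq_intros)
    moreover have "- 1 + y + exp (- y) \<ge> 0"
      using exp_ge_add_one_self[of "- y"] by simp
    ultimately show "\<exists>d. (?g has_real_derivative d) (at y) \<and> 0 \<le> d"
      by blast
  qed
  then show ?thesis by simp
qed

text \<open>Follows from \<open>ln z \<le> z - 1\<close> and the quadratic bound on the exponential.
  The left side is the log-moment generating function at \<open>- x\<close> of a Bernoulli variable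
  with mean \<open>q\<close>.\<close>

lemma ln_Bernoulli_mgf_le:
  fixes q x :: real
  assumes "0 \<le> q" "q \<le> 1" "x \<ge> 0"
  shows "ln (1 - q * (1 - exp (- x))) \<le> q * (x\<^sup>2 / 2 - x)"
proof -
  have "q * (1 - exp (- x)) \<le> 1 * (1 - exp (- x))"
    using assms by (intro mult_right_mono) auto
  also have "\<dots> < 1"
    by simp
  finally have pos: "1 - q * (1 - exp (- x)) > 0"
    by simp
  have "ln (1 - q * (1 - exp (- x))) \<le> q * (exp (- x) - 1)"
    using ln_le_minus_one[OF pos] by (simp add: algebra_simps)
  also have "\<dots> \<le> q * (x\<^sup>2 / 2 - x)"
    using exp_minus_le_quadratic[OF \<open>x \<ge> 0\<close>] \<open>0 \<le> q\<close> by (intro mult_left_mono) auto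
  finally show ?thesis .
qed

text \<open>
  For \<open>q > p\<close> the quadratic term \<open>q a\<^sup>2 / (2 p)\<close> is too large, but the logarithm is decreasing in
  \<open>q\<close>, so \<open>q\<close> may be replaced by \<open>p\<close>.
\<close>

lemma ln_tilted_Bernoulli_mgf_le:
  fixes p q a \<delta> :: real
  assumes "0 < p" "p \<le> 1" "0 \<le> q" "q \<le> 1" "0 \<le> a" "0 \<le> \<delta>" and near: "p - q \<le> p * \<delta>"
  shows "p * ln (1 - q * (1 - exp (- (a / p)))) + p * a \<le> a\<^sup>2 / 2 + p * \<delta> * a"
proof (cases "q \<le> p")
  \<comment> \<open>Here \<open>q / p \<le> 1\<close> controls the quadratic term, and
    \<open>near\<close> pays for the deficit \<open>(p - q) * a\<close> in the linear term.\<close>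
  case True
  have "p * ln (1 - q * (1 - exp (- (a / p)))) \<le> p * (q * ((a / p)\<^sup>2 / 2 - a / p))"
    using assms by (intro mult_left_mono ln_Bernoulli_mgf_le) auto
  also have "\<dots> = q / p * (a\<^sup>2 / 2) - q * a"
    using \<open>0 < p\<close> by (simp add: field_simps power2_eq_square)
  finally have "p * ln (1 - q * (1 - exp (- (a / p)))) \<le> q / p * (a\<^sup>2 / 2) - q * a" .
  moreover have "q / p * (a\<^sup>2 / 2) \<le> 1 * (a\<^sup>2 / 2)"
    using True \<open>0 < p\<close> by (intro mult_right_mono) auto
  moreover have "p * a - q * a \<le> p * \<delta> * a"
    using mult_right_mono[OF near \<open>0 \<le> a\<close>] by (simp add: algebra_simps)
  ultimately show ?thesis by linarith
next
  case False
  let ?u = "1 - exp (- (a / p))"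
  have u: "0 \<le> ?u" "?u < 1"
    using assms by auto
  have "q * ?u \<le> 1 * ?u"
    using assms u by (intro mult_right_mono) auto
  also have "\<dots> < 1"
    using u by simp
  finally have pos: "1 - q * ?u > 0"
    by simp
  have "p * ?u \<le> q * ?u"
    using False u by (intro mult_right_mono) auto
  then have "ln (1 - q * ?u) \<le> ln (1 - p * ?u)"
    using pos by simp
  also have "\<dots> \<le> p * ((a / p)\<^sup>2 / 2 - a / p)"
    using assms by (intro ln_Bernoulli_mgf_le) auto
  finally have "p * ln (1 - q * ?u) \<le> p * (p * ((a / p)\<^sup>2 / 2 - a / p))"
    using \<open>0 < p\<close> by (intro mult_left_mono) auto
  also have "\<dots> = a\<^sup>2 / 2 - p * a"
    using \<open>0 < p\<close> by (simp add: field_simps power2_eq_square)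
  finally have "p * ln (1 - q * ?u) + p * a \<le> a\<^sup>2 / 2"
    by simp
  moreover have "0 \<le> p * \<delta> * a"
    using assms by simp
  ultimately show ?thesis by linarith
qed

section \<open>The expected change of the potential in one round\<close>

lemma component_diff_le_spread: "x $ i - x $ j \<le> spread x"
  unfolding spread_def by (intro diff_mono Max_ge Min_le) auto

lemma norm_power2_eq_sum: "(norm (x :: real ^ 'n))\<^sup>2 = (\<Sum>i\<in>UNIV. (x $ i)\<^sup>2)"
  unfolding power2_norm_eq_inner inner_vec_def by (simp add: power2_eq_square)

text \<open>The estimate differs from \<open>lam\<close> in the coordinate \<open>I\<close> only, so
  a single summand changes.\<close>

lemma sum_loss_estimate:
  assumes "pmf P I > 0"
  shows "(\<Sum>i\<in>UNIV. pmf P i * exp (- \<eta> * loss_estimate s lam P I $ i))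
    = (\<Sum>i\<in>UNIV. pmf P i * exp (- \<eta> * lam $ i))
      - pmf P I * exp (- \<eta> * lam $ I) * (1 - exp (- (\<eta> * s $ I / pmf P I)))"
proof -
  have "exp (- \<eta> * (s $ I / pmf P I + lam $ I)) = exp (- \<eta> * lam $ I) * exp (- (\<eta> * s $ I / pmf P I))"
    by (simp add: algebra_simps flip: exp_add)
  then have "(\<Sum>i\<in>UNIV. pmf P i * exp (- \<eta> * loss_estimate s lam P I $ i))
      = (\<Sum>i\<in>UNIV. pmf P i * exp (- \<eta> * lam $ i)
        - (if i = I then pmf P I * exp (- \<eta> * lam $ I) * (1 - exp (- (\<eta> * s $ I / pmf P I))) else 0))"
    by (intro sum.cong refl) (auto simp: loss_estimate_def right_diff_distrib)
  then show ?thesis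
    by (simp add: sum_subtractf)
qed

text \<open>Since \<open>s + lam\<close> is the true loss, the left side is the conditional
  expectation of the potential increment plus \<open>\<eta>\<close> times the learner's
  loss.\<close>

lemma expected_mix_loss_gap_le:
  fixes s lam :: "real ^ 'n"
  assumes "\<eta> > 0" and P: "\<And>i. pmf P i > 0" and s: "\<And>i. 0 \<le> s $ i"
  shows "(\<Sum>I\<in>UNIV. pmf P I * ln (\<Sum>i\<in>UNIV. pmf P i * exp (- \<eta> * loss_estimate s lam P I $ i)))
      + \<eta> * (\<Sum>i\<in>UNIV. pmf P i * (s $ i + lam $ i))
    \<le> \<eta>\<^sup>2 * ((spread lam)\<^sup>2 / 8 + (norm s)\<^sup>2 / 2 + (MAX i\<in>UNIV. s $ i) * spread lam)"
proof -
  define w where "w i = exp (- \<eta> * lam $ i)" for i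
  define Z where "Z = (\<Sum>i\<in>UNIV. pmf P i * w i)"
  define q where "q i = pmf P i * w i / Z" for i
  define d where "d = spread lam"
  define M where "M = (MAX i\<in>UNIV. s $ i)"
  have sumP: "(\<Sum>i\<in>UNIV. pmf P i) = 1"
    by (simp add: sum_pmf_eq_1)
  have M: "s $ i \<le> M" for i
    unfolding M_def by (intro Max_ge) auto
  have "d \<ge> 0"
    using component_diff_le_spread[of lam undefined undefined] by (simp add: d_def)
  have Zpos: "Z > 0"
    unfolding Z_def w_def using P by (intro sum_pos) auto
  have q: "0 \<le> q i" "q i \<le> 1" for i
  proof -
    show "0 \<le> q i"
      using Zpos by (simp add: q_def w_def)
    have "pmf P i * w i \<le> Z"
      unfolding Z_def by (rule member_le_sum) (auto simp: w_def)
    then show "q i \<le> 1"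
      using Zpos by (simp add: q_def)
  qed
  \<comment> \<open>\<open>Z\<close> is an average of the \<open>w j\<close>, each at most
    \<open>w i * exp (\<eta> * d)\<close>. Hence \<open>w i / Z\<close> is at least
    \<open>exp (- (\<eta> * d))\<close>, which is at least \<open>1 - \<eta> * d\<close>.\<close>
  have near: "pmf P i - q i \<le> pmf P i * (\<eta> * d)" for i
  proof -
    have "Z \<le> (\<Sum>j\<in>UNIV. pmf P j * (w i * exp (\<eta> * d)))"
      unfolding Z_def
    proof (intro sum_mono mult_left_mono)
      fix j
      have "\<eta> * (lam $ i - lam $ j) \<le> \<eta> * d"
        using \<open>\<eta> > 0\<close> component_diff_le_spread[of lam i j] by (simp add: d_def)
      then show "w j \<le> w i * exp (\<eta> * d)"
        by (simp add: w_def algebra_simps flip: exp_add)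
    qed auto
    also have "\<dots> = w i * exp (\<eta> * d)"
      by (simp add: sumP flip: sum_distrib_right)
    finally have "exp (- (\<eta> * d)) \<le> w i / Z"
      using Zpos by (simp add: exp_minus field_simps)
    moreover have "1 - \<eta> * d \<le> exp (- (\<eta> * d))"
      using exp_ge_add_one_self[of "- (\<eta> * d)"] by simp
    ultimately have "pmf P i * (1 - \<eta> * d) \<le> pmf P i * (w i / Z)"
      by (intro mult_left_mono) auto
    then show ?thesis
      by (simp add: q_def algebra_simps)
  qed
  define B where "B I = 1 - q I * (1 - exp (- (\<eta> * s $ I / pmf P I)))" for I
  have split: "ln (\<Sum>i\<in>UNIV. pmf P i * exp (- \<eta> * loss_estimate s lam P I $ i)) = ln Z + ln (B I)" for I
  proof -
    have "q I * (1 - exp (- (\<eta> * s $ I / pmf P I))) \<le> 1 * (1 - exp (- (\<eta> * s $ I / pmf P I)))"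
      using q P s \<open>\<eta> > 0\<close> by (intro mult_right_mono) (auto simp: less_imp_le)
    also have "\<dots> < 1"
      by simp
    finally have "B I > 0"
      by (simp add: B_def)
    have "(\<Sum>i\<in>UNIV. pmf P i * exp (- \<eta> * loss_estimate s lam P I $ i)) = Z * B I"
      unfolding sum_loss_estimate[OF P] using Zpos by (simp add: B_def q_def Z_def w_def field_simps)
    then show ?thesis
      using Zpos \<open>B I > 0\<close> by (simp add: ln_mult)
  qed
  \<comment> \<open>Averaging over the draw cancels the importance weight: with
    \<open>a = \<eta> * s $ I\<close> and \<open>\<delta> = \<eta> * d\<close>, the quadratic term
    \<open>a\<^sup>2 / 2\<close> contains no inverse probability.\<close>
  have "(\<Sum>I\<in>UNIV. pmf P I * ln (B I) + pmf P I * (\<eta> * s $ I))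
      \<le> (\<Sum>I\<in>UNIV. (\<eta> * s $ I)\<^sup>2 / 2 + pmf P I * (\<eta>\<^sup>2 * (M * d)))"
  proof (intro sum_mono)
    fix I
    have "pmf P I * ln (B I) + pmf P I * (\<eta> * s $ I)
        \<le> (\<eta> * s $ I)\<^sup>2 / 2 + pmf P I * (\<eta> * d) * (\<eta> * s $ I)"
      unfolding B_def using P q s \<open>\<eta> > 0\<close> \<open>d \<ge> 0\<close> near[of I]
      by (intro ln_tilted_Bernoulli_mgf_le) (auto simp: pmf_le_1)
    also have "pmf P I * (\<eta> * d) * (\<eta> * s $ I) \<le> pmf P I * (\<eta> * d) * (\<eta> * M)"
      using M \<open>\<eta> > 0\<close> \<open>d \<ge> 0\<close> by (intro mult_left_mono) auto
    finally show "pmf P I * ln (B I) + pmf P I * (\<eta> * s $ I)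
        \<le> (\<eta> * s $ I)\<^sup>2 / 2 + pmf P I * (\<eta>\<^sup>2 * (M * d))"
      by (simp add: power2_eq_square mult_ac)
  qed
  also have "\<dots> = \<eta>\<^sup>2 * ((norm s)\<^sup>2 / 2 + M * d)"
    unfolding sum.distrib sum_distrib_right[symmetric] sumP norm_power2_eq_sum
    by (simp add: power_mult_distrib distrib_left flip: sum_distrib_left sum_divide_distrib)
  finally have bandit: "(\<Sum>I\<in>UNIV. pmf P I * ln (B I)) + \<eta> * (\<Sum>I\<in>UNIV. pmf P I * s $ I)
      \<le> \<eta>\<^sup>2 * ((norm s)\<^sup>2 / 2 + M * d)"
    by (simp add: sum.distrib sum_distrib_left mult_ac)
  have "ln Z \<le> - \<eta> * (\<Sum>i\<in>UNIV. pmf P i * lam $ i) + \<eta>\<^sup>2 * d\<^sup>2 / 8"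
    unfolding Z_def w_def d_def spread_def using \<open>\<eta> > 0\<close>
    by (intro ln_sum_exp_le_Hoeffding) auto
  with bandit show ?thesis
    unfolding split d_def[symmetric] M_def[symmetric]
    by (simp add: distrib_left sum.distrib sumP flip: sum_distrib_right)
qed

section \<open>Exponential weights and their log-partition function\<close>

definition log_partition :: "real \<Rightarrow> real ^ 'n \<Rightarrow> real" where
  "log_partition \<eta> L = ln (\<Sum>k\<in>UNIV. exp (- \<eta> * L $ k))"

lemma sum_exp_weights_pos: "(\<Sum>k\<in>UNIV. exp (- \<eta> * (L :: real ^ 'n) $ k)) > 0"
  by (intro sum_pos) auto

lemma pmf_exp_weights_pos: "pmf (exp_weights \<eta> L) i > 0"
  using sum_exp_weights_pos[of \<eta> L] by (simp add: pmf_exp_weights)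

text \<open>Factoring the old partition sum out of the new one leaves an average under the current
  weights, so the increment of the potential is a log-moment generating function.\<close>

lemma log_partition_add:
  "log_partition \<eta> (L + x)
    = log_partition \<eta> L + ln (\<Sum>k\<in>UNIV. pmf (exp_weights \<eta> L) k * exp (- \<eta> * x $ k))"
proof -
  define Z where "Z = (\<Sum>k\<in>UNIV. exp (- \<eta> * L $ k))"
  have "Z > 0"
    unfolding Z_def by (rule sum_exp_weights_pos)
  have "(\<Sum>k\<in>UNIV. exp (- \<eta> * (L + x) $ k))
      = Z * (\<Sum>k\<in>UNIV. pmf (exp_weights \<eta> L) k * exp (- \<eta> * x $ k))"
    unfolding pmf_exp_weights Z_def[symmetric] sum_distrib_left using \<open>Z > 0\<close>
    by (intro sum.cong refl) (simp add: distrib_left exp_diff exp_minus divide_inverse)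
  moreover have "(\<Sum>k\<in>UNIV. pmf (exp_weights \<eta> L) k * exp (- \<eta> * x $ k)) > 0"
    by (intro sum_pos) (auto simp: pmf_exp_weights_pos)
  ultimately show ?thesis
    using \<open>Z > 0\<close> by (simp add: log_partition_def ln_mult Z_def)
qed

text \<open>A single summand is at most the whole sum. Through this bound the best fixed expert
  enters the regret analysis.\<close>

lemma log_partition_ge: "- \<eta> * L $ i \<le> log_partition \<eta> L"
proof -
  have "exp (- \<eta> * L $ i) \<le> (\<Sum>k\<in>UNIV. exp (- \<eta> * L $ k))"
    by (rule member_le_sum) auto
  then show ?thesis
    unfolding log_partition_def using sum_exp_weights_pos[of \<eta> L] by (simp add: ln_ge_iff)
qed

lemma exp_weights_0: "exp_weights \<eta> 0 = pmf_of_set UNIV"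
  by (rule pmf_eqI) (simp add: pmf_exp_weights)

section \<open>Expectations under the law of the algorithm\<close>

lemma finite_set_exp3lb: "finite (set_pmf (exp3lb \<eta> l lam t))"
  by (induction t) (auto simp: Let_def case_prod_beta)

text \<open>The first round needs no special case: the cumulative estimate is then 0, and
  exponential weights at 0 are uniform.\<close>

lemma exp3lb_Suc_eq:
  "exp3lb \<eta> l lam (Suc t) = exp3lb \<eta> l lam t \<bind> (\<lambda>(Is, L).
    map_pmf (\<lambda>I. (Is @ [I],
      L + loss_estimate (l (Suc t) - lam (Suc t)) (lam (Suc t)) (exp_weights \<eta> L) I))
    (exp_weights \<eta> L))"
  by (cases "t = 0") (simp_all add: play_dist_def map_pmf_def Let_def exp_weights_0 bind_return_pmf)

lemma length_exp3lb: "(Is, L) \<in> set_pmf (exp3lb \<eta> l lam t) \<Longrightarrow> length Is = t"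
  by (induction t arbitrary: Is L) (auto simp: Let_def)

text \<open>The tower rule, conditioning on the first \<open>t\<close> rounds.\<close>

lemma expectation_exp3lb_Suc:
  fixes h :: "'n list \<times> (real ^ 'n) \<Rightarrow> real"
  shows "measure_pmf.expectation (exp3lb \<eta> l lam (Suc t)) h =
    measure_pmf.expectation (exp3lb \<eta> l lam t) (\<lambda>(Is, L). \<Sum>I\<in>UNIV. pmf (exp_weights \<eta> L) I *
      h (Is @ [I], L + loss_estimate (l (Suc t) - lam (Suc t)) (lam (Suc t)) (exp_weights \<eta> L) I))"
  unfolding exp3lb_Suc_eq
  by (subst pmf_expectation_bind[OF finite_set_exp3lb _ order_refl])
     (auto simp: integral_measure_pmf[OF finite_set_exp3lb] integral_measure_pmf[of UNIV]
        intro!: sum.cong)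

lemma expectation_exp3lb_mono:
  fixes f g :: "'n list \<times> (real ^ 'n) \<Rightarrow> real"
  assumes "\<And>x. x \<in> set_pmf (exp3lb \<eta> l lam t) \<Longrightarrow> f x \<le> g x"
  shows "measure_pmf.expectation (exp3lb \<eta> l lam t) f \<le> measure_pmf.expectation (exp3lb \<eta> l lam t) g"
  using assms
  by (intro integral_mono_AE) (auto simp: AE_measure_pmf_iff integrable_measure_pmf_finite finite_set_exp3lb)

text \<open>Round \<open>Suc t\<close> reads list position \<open>t\<close>, which holds the
  appended draw because \<open>Is\<close> has length \<open>t\<close>.\<close>

lemma learner_loss_snoc:
  assumes "length Is = t"
  shows "learner_loss l (Suc t) (Is @ [I]) = learner_loss l t Is + l (Suc t) $ I"
  using assms by (auto simp: learner_loss_def nth_append intro!: sum.cong)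

text \<open>Unbiasedness: the probability of drawing \<open>i\<close> cancels the denominator in the
  estimate, which requires that probability to be nonzero.\<close>

lemma sum_pmf_loss_estimate:
  assumes "\<And>i. pmf P i > 0"
  shows "(\<Sum>I\<in>UNIV. pmf P I * loss_estimate s lam P I $ i) = s $ i + lam $ i"
proof -
  have "(\<Sum>I\<in>UNIV. pmf P I * loss_estimate s lam P I $ i)
      = (\<Sum>I\<in>UNIV. (if I = i then s $ i else 0) + pmf P I * lam $ i)"
    using assms[of i] by (intro sum.cong) (auto simp: loss_estimate_def algebra_simps)
  then show ?thesis
    by (simp add: sum.distrib sum_pmf_eq_1 flip: sum_distrib_right)
qed

lemma expectation_cumulative_estimate:
  "measure_pmf.expectation (exp3lb \<eta> l lam t) (\<lambda>(Is, L). L $ i) = expert_loss l t i"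
proof (induction t)
  case 0
  show ?case by (simp add: expert_loss_def)
next
  case (Suc t)
  have "measure_pmf.expectation (exp3lb \<eta> l lam (Suc t)) (\<lambda>(Is, L). L $ i)
      = measure_pmf.expectation (exp3lb \<eta> l lam t) (\<lambda>x. (case x of (Is, L) \<Rightarrow> L $ i) + l (Suc t) $ i)"
    unfolding expectation_exp3lb_Suc
    by (intro arg_cong[where f = "measure_pmf.expectation _"])
       (auto simp: distrib_left sum.distrib sum_pmf_loss_estimate pmf_exp_weights_pos
        sum_pmf_eq_1 simp flip: sum_distrib_right)
  also have "\<dots> = expert_loss l (Suc t) i"
    by (subst Bochner_Integration.integral_add)
       (simp_all add: integrable_measure_pmf_finite finite_set_exp3lb Suc.IH expert_loss_def)
  finally show ?case .
qed

section \<open>Summation over the rounds and the regret bound\<close>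

text \<open>Four times this is the contribution of one round to the quantity bounded by
  \<open>Q\<close>.\<close>

definition round_bound :: "real ^ 'n \<Rightarrow> real ^ 'n \<Rightarrow> real" where
  "round_bound s lam = (spread lam)\<^sup>2 / 8 + (norm s)\<^sup>2 / 2 + (MAX i\<in>UNIV. s $ i) * spread lam"

lemma expectation_potential_le:
  fixes l lam :: "nat \<Rightarrow> real ^ 'n"
  assumes "\<eta> > 0" and "\<And>\<tau> i. \<tau> \<in> {1..t} \<Longrightarrow> lam \<tau> $ i \<le> l \<tau> $ i"
  shows "measure_pmf.expectation (exp3lb \<eta> l lam t)
      (\<lambda>(Is, L). \<eta> * learner_loss l t Is + log_partition \<eta> L)
    \<le> ln (real CARD('n)) + \<eta>\<^sup>2 * (\<Sum>\<tau>=1..t. round_bound (l \<tau> - lam \<tau>) (lam \<tau>))"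
  using assms(2)
proof (induction t)
  case 0
  show ?case by (simp add: learner_loss_def log_partition_def)
next
  case (Suc t)
  let ?s = "l (Suc t) - lam (Suc t)" and ?lam = "lam (Suc t)"
  have "measure_pmf.expectation (exp3lb \<eta> l lam (Suc t))
      (\<lambda>(Is, L). \<eta> * learner_loss l (Suc t) Is + log_partition \<eta> L)
    \<le> measure_pmf.expectation (exp3lb \<eta> l lam t)
      (\<lambda>x. (\<lambda>(Is, L). \<eta> * learner_loss l t Is + log_partition \<eta> L) x + \<eta>\<^sup>2 * round_bound ?s ?lam)"
    unfolding expectation_exp3lb_Suc
  proof (intro expectation_exp3lb_mono, unfold split_paired_all prod.case)
    fix Is and L :: "real ^ 'n"
    assume "(Is, L) \<in> set_pmf (exp3lb \<eta> l lam t)"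
    then have len: "length Is = t"
      by (rule length_exp3lb)
    let ?P = "exp_weights \<eta> L"
    let ?m = "\<lambda>I. ln (\<Sum>k\<in>UNIV. pmf ?P k * exp (- \<eta> * loss_estimate ?s ?lam ?P I $ k))"
    \<comment> \<open>The terms fixed before the draw are separated from the new ones, and the new
      loss is written as \<open>?s + ?lam\<close> to match
      \<open>expected_mix_loss_gap_le\<close>.\<close>
    have "(\<Sum>I\<in>UNIV. pmf ?P I * (\<eta> * learner_loss l (Suc t) (Is @ [I])
            + log_partition \<eta> (L + loss_estimate ?s ?lam ?P I)))
        = (\<Sum>I\<in>UNIV. pmf ?P I * (\<eta> * learner_loss l t Is + log_partition \<eta> L)
            + (pmf ?P I * ?m I + \<eta> * (pmf ?P I * (?s $ I + ?lam $ I))))"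
      unfolding learner_loss_snoc[OF len] log_partition_add
      by (intro sum.cong refl) (simp add: algebra_simps)
    also have "\<dots> = \<eta> * learner_loss l t Is + log_partition \<eta> L
        + ((\<Sum>I\<in>UNIV. pmf ?P I * ?m I) + \<eta> * (\<Sum>i\<in>UNIV. pmf ?P i * (?s $ i + ?lam $ i)))"
      unfolding sum.distrib sum_distrib_left[symmetric] sum_distrib_right[symmetric]
      by (simp add: sum_pmf_eq_1)
    also have "\<dots> \<le> \<eta> * learner_loss l t Is + log_partition \<eta> L + \<eta>\<^sup>2 * round_bound ?s ?lam"
      unfolding round_bound_def using \<open>\<eta> > 0\<close> Suc.prems[of "Suc t"]
      by (intro add_left_mono expected_mix_loss_gap_le) (auto simp: pmf_exp_weights_pos)
    finally show "(\<Sum>I\<in>UNIV. pmf ?P I * (\<eta> * learner_loss l (Suc t) (Is @ [I])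
          + log_partition \<eta> (L + loss_estimate ?s ?lam ?P I)))
        \<le> \<eta> * learner_loss l t Is + log_partition \<eta> L + \<eta>\<^sup>2 * round_bound ?s ?lam" .
  qed
  also have "\<dots> = measure_pmf.expectation (exp3lb \<eta> l lam t)
      (\<lambda>(Is, L). \<eta> * learner_loss l t Is + log_partition \<eta> L) + \<eta>\<^sup>2 * round_bound ?s ?lam"
    by (subst Bochner_Integration.integral_add)
       (simp_all add: integrable_measure_pmf_finite finite_set_exp3lb)
  also have "\<dots> \<le> ln (real CARD('n)) + \<eta>\<^sup>2 * (\<Sum>\<tau>=1..t. round_bound (l \<tau> - lam \<tau>) (lam \<tau>))
      + \<eta>\<^sup>2 * round_bound ?s ?lam"
    using Suc by (intro add_right_mono Suc.IH) auto
  finally show ?case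
    by (simp add: algebra_simps)
qed

lemma pseudo_regret_le:
  fixes l lam :: "nat \<Rightarrow> real ^ 'n"
  assumes "\<eta> > 0" and "\<And>t i. t \<in> {1..T} \<Longrightarrow> lam t $ i \<le> l t $ i"
  shows "pseudo_regret \<eta> l lam T
    \<le> 1 / \<eta> * ln (real CARD('n)) + \<eta> * (\<Sum>t=1..T. round_bound (l t - lam t) (lam t))"
proof -
  let ?E = "measure_pmf.expectation (exp3lb \<eta> l lam T)"
  let ?B = "\<Sum>t=1..T. round_bound (l t - lam t) (lam t)"
  have "(MIN i\<in>UNIV. expert_loss l T i) \<in> range (expert_loss l T)"
    by (intro Min_in) auto
  then obtain i where i: "(MIN i\<in>UNIV. expert_loss l T i) = expert_loss l T i"
    by (rule imageE)
  \<comment> \<open>The deterministic loss of the best expert \<open>i\<close> is replaced by the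
    expectation of its estimate, so that \<open>log_partition_ge\<close> applies pathwise.\<close>
  have "\<eta> * ?E (\<lambda>(Is, L). learner_loss l T Is) - \<eta> * expert_loss l T i
      = ?E (\<lambda>(Is, L). \<eta> * learner_loss l T Is - \<eta> * L $ i)"
    unfolding expectation_cumulative_estimate[of \<eta> l lam T i, symmetric]
    by (simp add: split_beta' integrable_measure_pmf_finite finite_set_exp3lb)
  also have "\<dots> \<le> ?E (\<lambda>(Is, L). \<eta> * learner_loss l T Is + log_partition \<eta> L)"
    using log_partition_ge[of \<eta> _ i] by (intro expectation_exp3lb_mono) auto
  also have "\<dots> \<le> ln (real CARD('n)) + \<eta>\<^sup>2 * ?B"
    using assms by (rule expectation_potential_le)
  finally have "\<eta> * pseudo_regret \<eta> l lam T \<le> ln (real CARD('n)) + \<eta>\<^sup>2 * ?B"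
    by (simp add: pseudo_regret_def i algebra_simps)
  then show ?thesis
    using \<open>\<eta> > 0\<close> by (simp add: field_simps power2_eq_square)
qed

theorem theorem1:
  fixes l lam s :: "nat \<Rightarrow> real ^ 'n" and T :: nat and Q :: real
  assumes "CARD('n) \<ge> 2" and "T \<ge> 1"
    and "\<And>t i. t \<in> {1..T} \<Longrightarrow> lam t $ i \<le> l t $ i"
    and "\<And>t. t \<in> {1..T} \<Longrightarrow> s t = l t - lam t"
    and "Q > 0"
    and "1/2 * sq_spread_sum lam T + 2 * (\<Sum>t=1..T. (norm (s t))\<^sup>2)
           + 4 * (\<Sum>t=1..T. (MAX i\<in>UNIV. s t $ i) * spread (lam t)) \<le> Q"
  shows "(\<forall>\<eta>>0. pseudo_regret \<eta> l lam T \<le> 1 / \<eta> * ln (real CARD('n)) + 1/4 * \<eta> * Q)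
    \<and> pseudo_regret (sqrt (4 * ln (real CARD('n)) / Q)) l lam T \<le> sqrt (Q * ln (real CARD('n)))"
proof -
  define K where "K = ln (real CARD('n))"
  have "K > 0"
    using assms(1) by (simp add: K_def)
  have "(\<Sum>t=1..T. round_bound (l t - lam t) (lam t)) = (\<Sum>t=1..T. round_bound (s t) (lam t))"
    using assms(4) by (intro sum.cong) auto
  also have "\<dots> = 1/4 * (1/2 * sq_spread_sum lam T + 2 * (\<Sum>t=1..T. (norm (s t))\<^sup>2)
      + 4 * (\<Sum>t=1..T. (MAX i\<in>UNIV. s t $ i) * spread (lam t)))"
    by (simp add: round_bound_def sq_spread_sum_def sum.distrib flip: sum_divide_distrib)
  also have "\<dots> \<le> Q / 4"
    using assms(6) by simp
  finally have le: "(\<Sum>t=1..T. round_bound (l t - lam t) (lam t)) \<le> Q / 4" .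
  have bound: "pseudo_regret \<eta> l lam T \<le> 1 / \<eta> * K + 1/4 * \<eta> * Q" if "\<eta> > 0" for \<eta>
    using pseudo_regret_le[where l = l and lam = lam and T = T, OF that assms(3)] mult_left_mono[OF le, of \<eta>] that
    unfolding K_def by linarith
  \<comment> \<open>This choice balances the two terms of \<open>bound\<close>: each equals half of
    \<open>sqrt (Q * K)\<close>.\<close>
  define \<eta> where "\<eta> = sqrt (4 * K / Q)"
  have "\<eta> > 0"
    using \<open>K > 0\<close> \<open>Q > 0\<close> by (simp add: \<eta>_def)
  have \<eta>: "\<eta> = 2 * sqrt K / sqrt Q"
    by (simp add: \<eta>_def real_sqrt_divide real_sqrt_mult)
  have "1 / \<eta> * K = sqrt Q * sqrt K / 2"
    using \<open>K > 0\<close> by (simp add: \<eta> field_simps flip: power2_eq_square)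
  moreover have "1/4 * \<eta> * Q = sqrt Q * sqrt K / 2"
    using \<open>Q > 0\<close> by (simp add: \<eta> field_simps flip: power2_eq_square)
  ultimately have "pseudo_regret \<eta> l lam T \<le> sqrt (Q * K)"
    using bound[OF \<open>\<eta> > 0\<close>] unfolding real_sqrt_mult by linarith
  with bound show ?thesis
    by (auto simp: \<eta>_def K_def)
qed

end
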